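(* Assume that for each $i\in\mathcal I$ the set $\Xi_i$ is closed and convex, and that $f(\mathbf x,\boldsymbol\xi)=\max_{k\le K}g_k(\mathbf x,\boldsymbol\xi)$, where, for each $k\le K$ and any fixed $\mathbf x\in X$, $g_k$ is a proper, concave and upper semicontinuous function of $\boldsymbol\xi$ and is not identically $\infty$ on $\Xi_i$. If a norm $\|\cdot\|$ on $\mathbb R^d$ is chosen as the transportation cost function $c$, then for any values of $\rho$ and $\varepsilon$ the problem $$\text{(P1)}\quad \inf_{\mathbf x,\lambda,\boldsymbol\mu,\eta,\widetilde{\mathbf p},\theta,\mathbf t}\ \lambda\rho+\eta+\theta\varepsilon+\sum_{i\in\mathcal I}\widehat p_i\left(\frac1{N_i}\sum_{j=1}^{N_i}t_{i,j}+\mu_i-\eta+\widetilde p_i\right)$$ subject to $$t_{i,j}\ge\sup_{\boldsymbol\xi\in\Xi_i}\left[f(\mathbf x,\boldsymbol\xi)-\theta\left\|\boldsymbol\xi-\widehat{\boldsymbol\xi}^{\,i}_j\right\|\right],\quad\forall i\in\mathcal I,\ \forall j\le N_i,$$ $$\left\|\left(\frac1{N_i}\sum_{j=1}^{N_i}t_{i,j}+\mu_i-\eta+\widetilde p_i\right)_{i\in\mathcal I}\right\|_*\le\lambda,$$ $$\mathbf x\in X,\ \lambda\ge0,\ \boldsymbol\mu\in\mathbb R_+^{|\mathcal I|},\ \eta\in\mathbb R,\ \widetilde{\mathbf p}\in\mathcal C^*,\ \theta\ge0,\ t_{i,j}\in\mathbb R\ \ \forall i\in\mathcal I,\ \forall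 j\le N_i,$$ is equivalent (same optimal value) to the following finite convex problem: $$\text{(P1')}\quad \inf_{\mathbf x,\lambda,\eta,\boldsymbol\mu,\widetilde{\mathbf p},\mathbf z_{ijk},\mathbf v_{ijk},\theta,\mathbf t}\ \lambda\rho+\eta+\theta\varepsilon+\sum_{i\in\mathcal I}\widehat p_i\left(\frac1{N_i}\sum_{j=1}^{N_i}t_{i,j}+\mu_i-\eta+\widetilde p_i\right)$$ subject to $$t_{i,j}\ge[-g_k]^*(\mathbf z_{ijk}-\mathbf v_{ijk})+S_{\Xi_i}(\mathbf v_{ijk})-\langle\mathbf z_{ijk},\widehat{\boldsymbol\xi}^{\,i}_j\rangle,\quad\forall i\in\mathcal I,\ \forall j\le N_i,\ \forall k\le K,$$ $$\|\mathbf z_{ijk}\|_*\le\theta,\quad\forall i\in\mathcal I,\ \forall j\le N_i,\ \forall k\le K,$$ $$\left\|\left(\frac1{N_i}\sum_{j=1}^{N_i}t_{i,j}+\mu_i-\eta+\widetilde p_i\right)_{i\in\mathcal I}\right\|_*\le\lambda,$$ $$\mathbf x\in X,\ \lambda\ge0,\ \theta\ge0,\ \eta\in\mathbb R,\ \boldsymbol\mu\in\mathbb R_+^{|\mathcal I|},\ \widetilde{\mathbf p}\in\mathcal C^*,\ \mathbf z_{ijk},\mathbf v_{ijk}\in\mathbb R^d,\ t_{i,j}\in\mathbb R\quad \forall i\in\mathcal I,\ \forall j\le N_i,\ \forall k\le K,$$ where $[-g_k]^*$ is the convex conjugate of $-g_k$ and $S_{\Xi_i}$ is the support function of $\Xi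_i$.
   Context: $X\subseteq\mathbb R^n$ is the set of feasible decisions. $\{\Xi_i\}_{i\in\mathcal I}$ is a finite family of subsets of $\mathbb R^d$ with pairwise disjoint interiors whose union is the support set $\Xi\subseteq\mathbb R^d$ of the random vector $\boldsymbol\xi$. The parameters $\rho,\varepsilon$ are non-negative. From a sample of size $N$ of $\boldsymbol\xi$, $\widehat{\boldsymbol\xi}^{\,i}_1,\dots,\widehat{\boldsymbol\xi}^{\,i}_{N_i}$ are the $N_i$ sample points in $\Xi_i$. $I'\subseteq\mathcal I$ is the set of indices of regions containing no sample point; for $i\in I'$ one sets $N_i=1$ and $\widehat{\boldsymbol\xi}^{\,i}_1:=\arg\sup_{\boldsymbol\xi\in\Xi_i}f(\mathbf x,\boldsymbol\xi)$ (supremum assumed attained). $\widehat p_i=N_i/(N+|I'|)$. $\mathcal C\subseteq\mathbb R^{|\mathcal I|}$ is a proper (convex, closed, full and pointed) cone with dual cone $\mathcal C^*=\{\mathbf y:\langle\mathbf y,\mathbf x\rangle\ge0\ \forall\mathbf x\in\mathcal C\}$. Dual norm: $\|\mathbf u\|_*=\sup_{\|\mathbf v\|\le1}\langle\mathbf u,\mathbf v\rangle$. In the constraint with right-hand side $\theta$, $\|\cdot\|_*$ is the dual of the norm on $\mathbb R^d$ chosen as transportation cost, $c(\boldsymbol\xi,\boldsymbol\xi')=\|\boldsymbol\xi-\boldsymbol\xi'\|$; in the constraint with right-hand side $\lambda$, $\|\cdot\|_*$ is the dual of a norm on $\mathbb R^{|\mathcal I|}$ (the one defining the cost $\widetilde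 c(\mathbf p,\mathbf q)=\|\mathbf p-\mathbf q\|$ between probability vectors). A function $h:\mathbb R^d\to\overline{\mathbb R}$ is proper if $h(\mathbf y)<+\infty$ for at least one $\mathbf y$ and $h(\mathbf y)>-\infty$ for all $\mathbf y$. Convex conjugate: $h^*(\mathbf y)=\sup_{\mathbf x\in\mathbb R^d}\langle\mathbf y,\mathbf x\rangle-h(\mathbf x)$. Support function: $S_A(\mathbf b)=\sup_{\mathbf a\in A}\langle\mathbf b,\mathbf a\rangle$. The dependence of $g_k$ on $\mathbf x$ is suppressed in (P1'): $[-g_k]^*$ is the conjugate of $\boldsymbol\xi\mapsto-g_k(\mathbf x,\boldsymbol\xi)$ for the current $\mathbf x$.
   Formalization: Convexity of (P1') is claimed for each fixed x in the remaining variables only, since X and g_k need not be convex in x (e.g. X={0,1}); "proper" and "not identically ∞ on Ξ_i" are read for -g_k. *)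

theory Defs
  imports "HOL-Analysis.Analysis"
begin

section \<open>Norms, cones, convex analysis\<close>

definition is_norm :: "('a::real_vector \<Rightarrow> real) \<Rightarrow> bool" where
  "is_norm nrm \<longleftrightarrow>
     (\<forall>u. 0 \<le> nrm u) \<and> (\<forall>u. nrm u = 0 \<longleftrightarrow> u = 0) \<and>
     (\<forall>c u. nrm (c *\<^sub>R u) = \<bar>c\<bar> * nrm u) \<and>
     (\<forall>u v. nrm (u + v) \<le> nrm u + nrm v)"

text \<open>The supremum is a genuine real number for every norm on a Euclidean space, because the unit
  ball of such a norm is nonempty and bounded.\<close>

definition dual_norm :: "('a::euclidean_space \<Rightarrow> real) \<Rightarrow> 'a \<Rightarrow> real" where
  "dual_norm nrm u = (SUP v\<in>{v. nrm v \<le> 1}. u \<bullet> v)"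

definition proper_cone :: "'a::euclidean_space set \<Rightarrow> bool" where
  "proper_cone C \<longleftrightarrow>
     convex_cone C \<and> closed C \<and> interior C \<noteq> {} \<and> (\<forall>y. y \<in> C \<and> - y \<in> C \<longrightarrow> y = 0)"

definition dual_cone :: "'a::real_inner set \<Rightarrow> 'a set" where
  "dual_cone C = {y. \<forall>x\<in>C. 0 \<le> y \<bullet> x}"

definition proper_fun :: "('a \<Rightarrow> ereal) \<Rightarrow> bool" where
  "proper_fun h \<longleftrightarrow> (\<exists>y. h y < \<infinity>) \<and> (\<forall>y. - \<infinity> < h y)"

text \<open>Concavity of an extended-valued function is convexity of its hypograph, a set of points with
  real second component; this avoids the sum of opposite infinities.\<close>

definition concave_fun :: "('a::real_vector \<Rightarrow> ereal) \<Rightarrow> bool" where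
  "concave_fun h \<longleftrightarrow> convex {(y, r::real). ereal r \<le> h y}"

definition usc_fun :: "('a::topological_space \<Rightarrow> ereal) \<Rightarrow> bool" where
  "usc_fun h \<longleftrightarrow> (\<forall>y c. h y < c \<longrightarrow> (\<forall>\<^sub>F y' in nhds y. h y' < c))"

definition convex_conjugate :: "('a::real_inner \<Rightarrow> ereal) \<Rightarrow> 'a \<Rightarrow> ereal" where
  "convex_conjugate h y = (SUP x. ereal (y \<bullet> x) - h x)"

definition support_fun :: "'a::real_inner set \<Rightarrow> 'a \<Rightarrow> ereal" where
  "support_fun A b = (SUP a\<in>A. ereal (b \<bullet> a))"


section \<open>Samples and regions\<close>

text \<open>The sample is \<open>s 1, \<dots>, s N\<close>. The regions overlap at most in boundary points, so a map
  \<open>reg\<close> records to which region (containing it) each sample point is counted.\<close>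

definition region_samples :: "nat \<Rightarrow> (nat \<Rightarrow> 'i) \<Rightarrow> 'i \<Rightarrow> nat set" where
  "region_samples N reg i = {l\<in>{1..N}. reg l = i}"

definition empty_regions :: "nat \<Rightarrow> (nat \<Rightarrow> 'i) \<Rightarrow> 'i set" where
  "empty_regions N reg = {i. region_samples N reg i = {}}"

definition num_points :: "nat \<Rightarrow> (nat \<Rightarrow> 'i) \<Rightarrow> 'i \<Rightarrow> nat" where
  "num_points N reg i =
     (if i \<in> empty_regions N reg then 1 else card (region_samples N reg i))"

definition p_hat :: "nat \<Rightarrow> (nat \<Rightarrow> 'i) \<Rightarrow> 'i \<Rightarrow> real" where
  "p_hat N reg i = real (num_points N reg i) / real (N + card (empty_regions N reg))"

text \<open>\<open>xi_hat s worst N reg x i j\<close> is the \<open>j\<close>-th point of region \<open>i\<close>, \<open>j\<close> counted from 1. In a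
  region without sample points it is \<open>worst x i\<close> (a maximiser of \<open>f x\<close> over the region), hence
  it depends on the decision \<open>x\<close>.\<close>

definition xi_hat ::
  "(nat \<Rightarrow> 'd) \<Rightarrow> ('x \<Rightarrow> 'i \<Rightarrow> 'd) \<Rightarrow> nat \<Rightarrow> (nat \<Rightarrow> 'i) \<Rightarrow> 'x \<Rightarrow> 'i \<Rightarrow> nat \<Rightarrow> 'd" where
  "xi_hat s worst N reg x i j =
     (if i \<in> empty_regions N reg then worst x i
      else s (sorted_list_of_set (region_samples N reg i) ! (j - 1)))"


section \<open>The two optimisation problems\<close>

text \<open>Below \<open>M i\<close> is the number of points in region \<open>i\<close>, \<open>ph i\<close> its empirical probability and
  \<open>xh x i j\<close> its \<open>j\<close>-th point. Entries of \<open>t\<close>, \<open>z\<close>, \<open>v\<close> outside the index ranges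
  \<open>1 \<le> j \<le> M i\<close>, \<open>1 \<le> k \<le> K\<close> are unconstrained and do not enter the objective.\<close>

definition slack_vec ::
  "('i::finite \<Rightarrow> nat) \<Rightarrow> real^'i \<Rightarrow> real \<Rightarrow> real^'i \<Rightarrow> ('i \<Rightarrow> nat \<Rightarrow> real) \<Rightarrow> real^'i" where
  "slack_vec M mu eta q t =
     (\<chi> i. (\<Sum>j=1..M i. t i j) / real (M i) + mu $ i - eta + q $ i)"

definition objective ::
  "real \<Rightarrow> real \<Rightarrow> ('i::finite \<Rightarrow> nat) \<Rightarrow> ('i \<Rightarrow> real) \<Rightarrow>
   real \<Rightarrow> real^'i \<Rightarrow> real \<Rightarrow> real^'i \<Rightarrow> real \<Rightarrow> ('i \<Rightarrow> nat \<Rightarrow> real) \<Rightarrow> real" where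
  "objective \<rho> \<epsilon> M ph lam mu eta q theta t =
     lam * \<rho> + eta + theta * \<epsilon> + (\<Sum>i\<in>UNIV. ph i * slack_vec M mu eta q t $ i)"

definition common_constraints ::
  "(real^'i \<Rightarrow> real) \<Rightarrow> (real^'i) set \<Rightarrow> ('i::finite \<Rightarrow> nat) \<Rightarrow>
   real \<Rightarrow> real^'i \<Rightarrow> real \<Rightarrow> real^'i \<Rightarrow> real \<Rightarrow> ('i \<Rightarrow> nat \<Rightarrow> real) \<Rightarrow> bool" where
  "common_constraints nrmP C M lam mu eta q theta t \<longleftrightarrow>
     dual_norm nrmP (slack_vec M mu eta q t) \<le> lam \<and>
     0 \<le> lam \<and> (\<forall>i. 0 \<le> mu $ i) \<and> q \<in> dual_cone C \<and> 0 \<le> theta"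

definition P1_feasible ::
  "'x set \<Rightarrow> ('x \<Rightarrow> real^'d \<Rightarrow> ereal) \<Rightarrow> ('i::finite \<Rightarrow> (real^'d) set) \<Rightarrow> (real^'d \<Rightarrow> real) \<Rightarrow>
   (real^'i \<Rightarrow> real) \<Rightarrow> (real^'i) set \<Rightarrow> ('i \<Rightarrow> nat) \<Rightarrow> ('x \<Rightarrow> 'i \<Rightarrow> nat \<Rightarrow> real^'d) \<Rightarrow>
   'x \<Rightarrow> real \<Rightarrow> real^'i \<Rightarrow> real \<Rightarrow> real^'i \<Rightarrow> real \<Rightarrow> ('i \<Rightarrow> nat \<Rightarrow> real) \<Rightarrow> bool" where
  "P1_feasible X f Xi nrm nrmP C M xh x lam mu eta q theta t \<longleftrightarrow>
     x \<in> X \<and> common_constraints nrmP C M lam mu eta q theta t \<and>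
     (\<forall>i. \<forall>j\<in>{1..M i}.
        ereal (t i j) \<ge> (SUP \<xi>\<in>Xi i. f x \<xi> - ereal (theta * nrm (\<xi> - xh x i j))))"

definition P1_value ::
  "real \<Rightarrow> real \<Rightarrow> ('i \<Rightarrow> real) \<Rightarrow>
   'x set \<Rightarrow> ('x \<Rightarrow> real^'d \<Rightarrow> ereal) \<Rightarrow> ('i::finite \<Rightarrow> (real^'d) set) \<Rightarrow> (real^'d \<Rightarrow> real) \<Rightarrow>
   (real^'i \<Rightarrow> real) \<Rightarrow> (real^'i) set \<Rightarrow> ('i \<Rightarrow> nat) \<Rightarrow> ('x \<Rightarrow> 'i \<Rightarrow> nat \<Rightarrow> real^'d) \<Rightarrow> ereal" where
  "P1_value \<rho> \<epsilon> ph X f Xi nrm nrmP C M xh =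
     Inf {ereal (objective \<rho> \<epsilon> M ph lam mu eta q theta t) | x lam mu eta q theta t.
            P1_feasible X f Xi nrm nrmP C M xh x lam mu eta q theta t}"

definition P1'_feasible ::
  "'x set \<Rightarrow> nat \<Rightarrow> (nat \<Rightarrow> 'x \<Rightarrow> real^'d \<Rightarrow> ereal) \<Rightarrow> ('i::finite \<Rightarrow> (real^'d) set) \<Rightarrow>
   (real^'d \<Rightarrow> real) \<Rightarrow> (real^'i \<Rightarrow> real) \<Rightarrow> (real^'i) set \<Rightarrow> ('i \<Rightarrow> nat) \<Rightarrow>
   ('x \<Rightarrow> 'i \<Rightarrow> nat \<Rightarrow> real^'d) \<Rightarrow>
   'x \<Rightarrow> real \<Rightarrow> real^'i \<Rightarrow> real \<Rightarrow> real^'i \<Rightarrow> ('i \<Rightarrow> nat \<Rightarrow> nat \<Rightarrow> real^'d) \<Rightarrow>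
   ('i \<Rightarrow> nat \<Rightarrow> nat \<Rightarrow> real^'d) \<Rightarrow> real \<Rightarrow> ('i \<Rightarrow> nat \<Rightarrow> real) \<Rightarrow> bool" where
  "P1'_feasible X K g Xi nrm nrmP C M xh x lam mu eta q z v theta t \<longleftrightarrow>
     x \<in> X \<and> common_constraints nrmP C M lam mu eta q theta t \<and>
     (\<forall>i. \<forall>j\<in>{1..M i}. \<forall>k\<in>{1..K}.
        ereal (t i j) \<ge> convex_conjugate (\<lambda>\<xi>. - g k x \<xi>) (z i j k - v i j k)
                        + support_fun (Xi i) (v i j k) - ereal (z i j k \<bullet> xh x i j)) \<and>
     (\<forall>i. \<forall>j\<in>{1..M i}. \<forall>k\<in>{1..K}. dual_norm nrm (z i j k) \<le> theta)"

definition P1'_value ::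
  "real \<Rightarrow> real \<Rightarrow> ('i \<Rightarrow> real) \<Rightarrow>
   'x set \<Rightarrow> nat \<Rightarrow> (nat \<Rightarrow> 'x \<Rightarrow> real^'d \<Rightarrow> ereal) \<Rightarrow> ('i::finite \<Rightarrow> (real^'d) set) \<Rightarrow>
   (real^'d \<Rightarrow> real) \<Rightarrow> (real^'i \<Rightarrow> real) \<Rightarrow> (real^'i) set \<Rightarrow> ('i \<Rightarrow> nat) \<Rightarrow>
   ('x \<Rightarrow> 'i \<Rightarrow> nat \<Rightarrow> real^'d) \<Rightarrow> ereal" where
  "P1'_value \<rho> \<epsilon> ph X K g Xi nrm nrmP C M xh =
     Inf {ereal (objective \<rho> \<epsilon> M ph lam mu eta q theta t) | x lam mu eta q z v theta t.
            P1'_feasible X K g Xi nrm nrmP C M xh x lam mu eta q z v theta t}"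

text \<open>Convexity of the second problem in all its variables other than the decision \<open>x\<close> (no
  convexity in \<open>x\<close> is assumed of \<open>X\<close> or \<open>g\<close>): the feasible set is convex and the objective is
  convex on it. It is spelled out with componentwise convex combinations since function types are
  not an instance of the class of real vector spaces, so \<open>convex_on\<close> does not apply.\<close>

definition P1'_convex_at ::
  "real \<Rightarrow> real \<Rightarrow> ('i \<Rightarrow> real) \<Rightarrow>
   'x set \<Rightarrow> nat \<Rightarrow> (nat \<Rightarrow> 'x \<Rightarrow> real^'d \<Rightarrow> ereal) \<Rightarrow> ('i::finite \<Rightarrow> (real^'d) set) \<Rightarrow>
   (real^'d \<Rightarrow> real) \<Rightarrow> (real^'i \<Rightarrow> real) \<Rightarrow> (real^'i) set \<Rightarrow> ('i \<Rightarrow> nat) \<Rightarrow>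
   ('x \<Rightarrow> 'i \<Rightarrow> nat \<Rightarrow> real^'d) \<Rightarrow> 'x \<Rightarrow> bool" where
  "P1'_convex_at \<rho> \<epsilon> ph X K g Xi nrm nrmP C M xh x \<longleftrightarrow>
     (\<forall>lam mu eta q z v theta t lam' mu' eta' q' z' v' theta' t'. \<forall>a\<ge>0. \<forall>b\<ge>0. a + b = 1 \<longrightarrow>
        P1'_feasible X K g Xi nrm nrmP C M xh x lam mu eta q z v theta t \<longrightarrow>
        P1'_feasible X K g Xi nrm nrmP C M xh x lam' mu' eta' q' z' v' theta' t' \<longrightarrow>
        P1'_feasible X K g Xi nrm nrmP C M xh x
          (a * lam + b * lam') (a *\<^sub>R mu + b *\<^sub>R mu') (a * eta + b * eta') (a *\<^sub>R q + b *\<^sub>R q')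
          (\<lambda>i j k. a *\<^sub>R z i j k + b *\<^sub>R z' i j k) (\<lambda>i j k. a *\<^sub>R v i j k + b *\<^sub>R v' i j k)
          (a * theta + b * theta') (\<lambda>i j. a * t i j + b * t' i j) \<and>
        objective \<rho> \<epsilon> M ph
          (a * lam + b * lam') (a *\<^sub>R mu + b *\<^sub>R mu') (a * eta + b * eta') (a *\<^sub>R q + b *\<^sub>R q')
          (a * theta + b * theta') (\<lambda>i j. a * t i j + b * t' i j)
        \<le> a * objective \<rho> \<epsilon> M ph lam mu eta q theta t
          + b * objective \<rho> \<epsilon> M ph lam' mu' eta' q' theta' t')"

end

theory Submission
  imports Defs
begin

text \<open>For a fixed decision, the constraint on \<open>t\<^sub>i\<^sub>j\<close> in the first problem is one bound for each piece
  \<open>g\<^sub>k\<close>: on \<open>A = \<Xi>\<^sub>i\<close>, with \<open>p\<close> the sample point, \<open>g(y) - \<theta> \<parallel>y - p\<parallel> \<le> t\<close>. The second problem replaces it by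
  a dual certificate: vectors \<open>z\<close>, \<open>v\<close> with \<open>[-g]\<^sup>*(z - v) + S(v) - \<langle>z, p\<rangle> \<le> t\<close> and \<open>\<parallel>z\<parallel>\<^sub>* \<le> \<theta>\<close>. That a
  certificate implies the bound is weak duality (\<open>dual_certificate_weak_duality\<close>), so the value of
  the first problem is at most that of the second.

  The converse fails for individual points. The conjugate of \<open>-g\<close> plus the indicator of \<open>A\<close> is only
  the closure of the infimal convolution of \<open>[-g]\<^sup>*\<close> and \<open>S\<close>, and the domain of \<open>g\<close> may merely touch
  \<open>A\<close>. For instance, on the line let \<open>g(y) = sqrt y\<close> for \<open>y \<ge> 0\<close> and \<open>-\<infinity>\<close> elsewhere, let \<open>A\<close> be the
  half-line \<open>y \<le> 0\<close>, and \<open>p = 0\<close>: the bound holds with \<open>t = 0\<close>, but \<open>[-g]\<^sup>*(w) = -1 / (4 w)\<close> for \<open>w < 0\<close>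
  (and \<open>\<infinity>\<close> otherwise) is always positive and \<open>S \<ge> 0\<close>, so no certificate reaches \<open>t = 0\<close>.

  What remains true is that the bound puts a point in the closure of the set of attained dual values
  (\<open>zero_in_closure_certificate_values\<close>, by separation and the Fenchel-Moreau theorem), which yields
  a certificate for \<open>t + \<delta>\<close> and \<open>\<theta> + \<delta>\<close>, for every \<open>\<delta> > 0\<close>
  (\<open>dual_certificate_near_primal_bound\<close>). This relaxation is affordable: if \<open>\<eta>\<close> is raised by \<open>\<delta>\<close>
  as well, the vector of averages \<open>t\<^sub>i\<^sub>j\<close> plus \<open>\<mu>\<^sub>i - \<eta> + q\<^sub>i\<close> does not change (\<open>slack_vec_shift\<close>), so all
  other constraints persist and the objective grows by \<open>\<delta> (1 + \<epsilon>)\<close>, which tends to 0. Hence the two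
  infima agree. Convexity of the second problem follows because certificates, written with epigraphs
  of the two conjugates, form a convex set, and the objective is affine.\<close>

section \<open>Affine minorants of closed convex epigraphs\<close>

text \<open>Extended-valued functions are handled through epigraphs, sets of points with a real last
  component, so that the convex duality below needs no infinite values. If \<open>E\<close> is the epigraph of
  \<open>h\<close>, then \<open>conj_epi E\<close> is the epigraph of the conjugate of \<open>h\<close>: it lists the affine minorants
  \<open>\<langle>w, \<cdot>\<rangle> - \<beta>\<close> of \<open>h\<close>.\<close>

definition conj_epi :: "('a::real_inner \<times> real) set \<Rightarrow> ('a \<times> real) set" where
  "conj_epi E = {(w, \<beta>). \<forall>(\<xi>, r)\<in>E. w \<bullet> \<xi> - \<beta> \<le> r}"

text \<open>The epigraph of the support function of \<open>A\<close>: the half-spaces that contain \<open>A\<close>.\<close>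

definition supp_epi :: "'a::real_inner set \<Rightarrow> ('a \<times> real) set" where
  "supp_epi A = {(v, b). \<forall>a\<in>A. v \<bullet> a \<le> b}"

lemma conj_epi_D: "(w, \<beta>) \<in> conj_epi E \<Longrightarrow> (\<xi>, r) \<in> E \<Longrightarrow> w \<bullet> \<xi> - \<beta> \<le> r"
  by (auto simp: conj_epi_def)

lemma convex_conj_epi: "convex (conj_epi E)"
proof (rule convexI)
  fix p q :: "'a \<times> real" and a b :: real
  assume p: "p \<in> conj_epi E" and q: "q \<in> conj_epi E" and ab: "0 \<le> a" "0 \<le> b" "a + b = 1"
  have "(a *\<^sub>R fst p + b *\<^sub>R fst q) \<bullet> \<xi> - (a * snd p + b * snd q) \<le> r" if "(\<xi>, r) \<in> E" for \<xi> r
  proof -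
    have "a * (fst p \<bullet> \<xi> - snd p) + b * (fst q \<bullet> \<xi> - snd q) \<le> a * r + b * r"
      using p q that ab by (intro add_mono mult_left_mono) (auto simp: conj_epi_def)
    also have "\<dots> = r" using ab by (metis distrib_right mult_1)
    finally show ?thesis by (simp add: inner_add_left algebra_simps)
  qed
  then show "a *\<^sub>R p + b *\<^sub>R q \<in> conj_epi E"
    by (auto simp: conj_epi_def case_prod_beta)
qed

lemma supp_epi_eq_conj_epi: "supp_epi A = conj_epi (A \<times> {0..})"
  unfolding supp_epi_def conj_epi_def by (intro Collect_cong) force

lemma convex_supp_epi: "convex (supp_epi A)"
  unfolding supp_epi_eq_conj_epi by (rule convex_conj_epi)

lemma supp_epi_scale:
  assumes "(v, b) \<in> supp_epi A" "0 \<le> c"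
  shows "(c *\<^sub>R v, c * b) \<in> supp_epi A"
  using assms by (auto simp: supp_epi_def intro: mult_left_mono)

lemma supp_epi_separates:
  fixes A :: "'a::euclidean_space set"
  assumes "convex A" "closed A" "y \<notin> A"
  obtains v b where "(v, b) \<in> supp_epi A" "b < v \<bullet> y"
proof -
  obtain a c where ac: "a \<bullet> y < c" "\<And>x. x \<in> A \<Longrightarrow> c < a \<bullet> x"
    using separating_hyperplane_closed_point[OF assms] by auto
  have "(- a, - c) \<in> supp_epi A" using ac(2) by (force simp: supp_epi_def)
  moreover have "- c < (- a) \<bullet> y" using ac(1) by simp
  ultimately show ?thesis using that by blast
qed

text \<open>Since \<open>E\<close> is unbounded upwards, a hyperplane below it cannot have a normal that points
  downwards. The normal may still be horizontal, \<open>\<alpha> = 0\<close>.\<close>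

lemma separating_upward_closed:
  fixes E :: "('a::euclidean_space \<times> real) set"
  assumes "convex E" "closed E" and up: "\<forall>y r r'. (y, r) \<in> E \<longrightarrow> r \<le> r' \<longrightarrow> (y, r') \<in> E"
    and ne: "E \<noteq> {}" and out: "(y, m) \<notin> E"
  obtains a \<alpha> c where "0 \<le> \<alpha>" "a \<bullet> y + \<alpha> * m < c" "\<forall>(\<xi>, r)\<in>E. c < a \<bullet> \<xi> + \<alpha> * r"
proof -
  obtain p c where pc: "p \<bullet> (y, m) < c" "\<forall>x\<in>E. c < p \<bullet> x"
    using separating_hyperplane_closed_point[OF assms(1,2) out] by blast
  obtain a \<alpha> where p: "p = (a, \<alpha>)" by fastforce
  obtain y0 r0 where e0: "(y0, r0) \<in> E" using ne by auto
  have "0 \<le> \<alpha>"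
  proof (rule ccontr)
    assume "\<not> 0 \<le> \<alpha>"
    define s where "s = \<bar>a \<bullet> y0 + \<alpha> * r0 - c\<bar> / (- \<alpha>)"
    have "0 \<le> s" using \<open>\<not> 0 \<le> \<alpha>\<close> unfolding s_def by (intro divide_nonneg_pos) auto
    then have "(y0, r0 + s) \<in> E" using up e0 by simp
    from bspec[OF pc(2) this] have "c < a \<bullet> y0 + \<alpha> * r0 + \<alpha> * s" by (simp add: p algebra_simps)
    moreover have "\<alpha> * s = - \<bar>a \<bullet> y0 + \<alpha> * r0 - c\<bar>" using \<open>\<not> 0 \<le> \<alpha>\<close> by (simp add: s_def)
    ultimately show False by linarith
  qed
  moreover have "\<forall>(\<xi>, r)\<in>E. c < a \<bullet> \<xi> + \<alpha> * r" using pc(2) by (fastforce simp: p)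
  ultimately show ?thesis using that pc(1) by (simp add: p)
qed

lemma affine_minorant_of_separation:
  fixes a :: "'a::real_inner"
  assumes "0 < \<alpha>" "\<forall>(\<xi>, r)\<in>E. c < a \<bullet> \<xi> + \<alpha> * r"
  shows "(- (a /\<^sub>R \<alpha>), - (c / \<alpha>)) \<in> conj_epi E"
  using assms by (fastforce simp: conj_epi_def divide_simps algebra_simps)

text \<open>The Fenchel-Moreau theorem in geometric form: a point outside the epigraph lies below an affine
  minorant. A hyperplane that separates the point from \<open>E\<close> is such a minorant unless it is vertical;
  then a large multiple of it is added to some fixed affine minorant. The latter exists because \<open>E\<close>
  contains no full vertical line over \<open>y0\<close>, which forces any hyperplane separating \<open>(y0, r1)\<close> from
  \<open>E\<close> to be non-vertical.\<close>

lemma affine_minorant_above: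
  fixes E :: "('a::euclidean_space \<times> real) set"
  assumes E: "convex E" "closed E" and up: "\<forall>y r r'. (y, r) \<in> E \<longrightarrow> r \<le> r' \<longrightarrow> (y, r') \<in> E"
    and e0: "(y0, r0) \<in> E" and novert: "(y0, r1) \<notin> E" and out: "(y, m) \<notin> E"
  obtains w \<beta> where "(w, \<beta>) \<in> conj_epi E" "m < w \<bullet> y - \<beta>"
proof -
  have ne: "E \<noteq> {}" using e0 by auto
  obtain a0 \<alpha>0 c0 where s0: "0 \<le> \<alpha>0" "a0 \<bullet> y0 + \<alpha>0 * r1 < c0"
    "\<forall>(\<xi>, r)\<in>E. c0 < a0 \<bullet> \<xi> + \<alpha>0 * r"
    by (rule separating_upward_closed[OF E up ne novert])
  have "\<alpha>0 \<noteq> 0" using s0(2) s0(3) e0 by auto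
  then have "0 < \<alpha>0" using s0(1) by simp
  from affine_minorant_of_separation[OF this s0(3)]
  obtain w0 \<beta>0 where w0: "(w0, \<beta>0) \<in> conj_epi E" by blast
  obtain a \<alpha> c where s: "0 \<le> \<alpha>" "a \<bullet> y + \<alpha> * m < c"
    "\<forall>(\<xi>, r)\<in>E. c < a \<bullet> \<xi> + \<alpha> * r"
    by (rule separating_upward_closed[OF E up ne out])
  show ?thesis
  proof (cases "\<alpha> = 0")
    case False
    then have "0 < \<alpha>" using s(1) by simp
    from affine_minorant_of_separation[OF this s(3)] show ?thesis
    proof (rule that)
      show "m < - (a /\<^sub>R \<alpha>) \<bullet> y - - (c / \<alpha>)"
        using s(2) \<open>0 < \<alpha>\<close> by (simp add: divide_simps algebra_simps)
    qed
  next
    case True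
    define d where "d = c - a \<bullet> y"
    have "0 < d" using s(2) True by (simp add: d_def)
    define k where "k = (\<bar>m - (w0 \<bullet> y - \<beta>0)\<bar> + 1) / d"
    have k: "0 \<le> k" "k * d = \<bar>m - (w0 \<bullet> y - \<beta>0)\<bar> + 1" using \<open>0 < d\<close> by (auto simp: k_def)
    have "(w0 - k *\<^sub>R a) \<bullet> \<xi> - (\<beta>0 - k * c) \<le> r" if "(\<xi>, r) \<in> E" for \<xi> r
    proof -
      have "k * c \<le> k * (a \<bullet> \<xi>)" using s(3) that True k(1) by (intro mult_left_mono) auto
      then show ?thesis using conj_epi_D[OF w0 that] by (simp add: inner_diff_left)
    qed
    then have "(w0 - k *\<^sub>R a, \<beta>0 - k * c) \<in> conj_epi E" by (auto simp: conj_epi_def)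
    moreover have "m < (w0 - k *\<^sub>R a) \<bullet> y - (\<beta>0 - k * c)"
      using k(2) by (simp add: d_def inner_diff_left right_diff_distrib)
    ultimately show ?thesis using that by blast
  qed
qed

section \<open>Norms\<close>

lemma is_norm_nonneg: "is_norm nrm \<Longrightarrow> 0 \<le> nrm u"
  and is_norm_eq_0: "is_norm nrm \<Longrightarrow> nrm u = 0 \<longleftrightarrow> u = 0"
  and is_norm_scaleR: "is_norm nrm \<Longrightarrow> nrm (c *\<^sub>R u) = \<bar>c\<bar> * nrm u"
  and is_norm_triangle: "is_norm nrm \<Longrightarrow> nrm (u + v) \<le> nrm u + nrm v"
  unfolding is_norm_def by blast+

lemma is_norm_0: "is_norm nrm \<Longrightarrow> nrm 0 = 0"
  by (simp add: is_norm_eq_0)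

lemmas is_norm_rules = is_norm_nonneg is_norm_eq_0 is_norm_0 is_norm_scaleR is_norm_triangle

lemma is_norm_minus: "is_norm nrm \<Longrightarrow> nrm (- u) = nrm u"
  using is_norm_scaleR[of nrm "- 1" u] by simp

lemma is_norm_convex: "is_norm nrm \<Longrightarrow> convex_on UNIV nrm"
proof (rule convex_onI)
  fix a :: real and u v :: 'a
  assume n: "is_norm nrm" and a: "0 < a" "a < 1"
  have "nrm ((1 - a) *\<^sub>R u + a *\<^sub>R v) \<le> nrm ((1 - a) *\<^sub>R u) + nrm (a *\<^sub>R v)"
    by (rule is_norm_triangle[OF n])
  also have "\<dots> = (1 - a) * nrm u + a * nrm v" using a by (simp add: is_norm_rules[OF n])
  finally show "nrm ((1 - a) *\<^sub>R u + a *\<^sub>R v) \<le> (1 - a) * nrm u + a * nrm v" .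
qed simp

text \<open>On a Euclidean space every convex function that is finite everywhere is continuous.\<close>

lemma is_norm_continuous:
  fixes nrm :: "'a::euclidean_space \<Rightarrow> real"
  assumes "is_norm nrm" shows "continuous_on UNIV nrm"
  by (rule convex_on_continuous[OF open_UNIV is_norm_convex[OF assms]])

lemma is_norm_dominates_norm:
  fixes nrm :: "'a::euclidean_space \<Rightarrow> real"
  assumes n: "is_norm nrm"
  obtains B where "0 < B" "\<And>v. norm v \<le> B * nrm v"
proof -
  have "compact (sphere (0::'a) 1)" "sphere (0::'a) 1 \<noteq> {}" by auto
  moreover have "continuous_on (sphere 0 1) nrm"
    using is_norm_continuous[OF n] continuous_on_subset by blast
  ultimately obtain u where u: "norm u = 1" "\<And>v. norm v = 1 \<Longrightarrow> nrm u \<le> nrm v"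
    using continuous_attains_inf[of "sphere 0 1" nrm] by auto
  have "nrm u \<noteq> 0" using u(1) by (auto simp: is_norm_rules[OF n])
  then have pos: "0 < nrm u" by (simp add: is_norm_rules[OF n] less_le)
  have "norm v \<le> (1 / nrm u) * nrm v" for v
  proof (cases "v = 0")
    case False
    have "nrm u \<le> nrm (v /\<^sub>R norm v)" using False by (intro u(2)) simp
    also have "\<dots> = nrm v / norm v" by (simp add: is_norm_rules[OF n] divide_inverse mult.commute)
    finally show ?thesis using False pos by (simp add: field_simps)
  qed (simp add: is_norm_0[OF n])
  then show ?thesis using that[of "1 / nrm u"] pos by simp
qed

text \<open>The right-hand side is linear in \<open>u\<close> and free of suprema. That the supremum in the definition is over a bounded set comes from the
  equivalence of norms.\<close>

lemma dual_norm_le_iff: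
  fixes nrm :: "'a::euclidean_space \<Rightarrow> real"
  assumes n: "is_norm nrm" and c: "0 \<le> c"
  shows "dual_norm nrm u \<le> c \<longleftrightarrow> (\<forall>v. u \<bullet> v \<le> c * nrm v)"
proof
  assume *: "\<forall>v. u \<bullet> v \<le> c * nrm v"
  have "0 \<in> {v. nrm v \<le> 1}" by (simp add: is_norm_rules[OF n])
  moreover have "u \<bullet> v \<le> c" if "nrm v \<le> 1" for v
    using * that c by (smt (verit) mult_left_le)
  ultimately show "dual_norm nrm u \<le> c"
    unfolding dual_norm_def by (intro cSUP_least) auto
next
  assume le: "dual_norm nrm u \<le> c"
  obtain B where B: "0 < B" "\<And>v. norm v \<le> B * nrm v" using is_norm_dominates_norm[OF n] by metis
  have "u \<bullet> v \<le> norm u * B" if "nrm v \<le> 1" for v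
  proof -
    have "norm v \<le> B" using B(2)[of v] B(1) that by (smt (verit) mult_left_le)
    then show ?thesis by (meson mult_left_mono norm_cauchy_schwarz norm_ge_zero order_trans)
  qed
  then have bdd: "bdd_above ((\<bullet>) u ` {v. nrm v \<le> 1})" by (auto simp: bdd_above_def)
  show "\<forall>v. u \<bullet> v \<le> c * nrm v"
  proof
    fix v
    show "u \<bullet> v \<le> c * nrm v"
    proof (cases "v = 0")
      case False
      then have pos: "0 < nrm v" by (simp add: is_norm_rules[OF n] less_le)
      then have "nrm (v /\<^sub>R nrm v) \<le> 1" by (simp add: is_norm_scaleR[OF n])
      then have "u \<bullet> (v /\<^sub>R nrm v) \<le> c"
        using le cSUP_upper[OF _ bdd, of "v /\<^sub>R nrm v"] by (simp add: dual_norm_def)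
      then show ?thesis using pos by (simp add: field_simps)
    qed (simp add: is_norm_0[OF n])
  qed
qed

text \<open>A norm is the supremum of the functionals in its dual unit ball. This follows from
  Fenchel-Moreau for the norm itself: by homogeneity, an affine minorant of a norm stays one when its
  constant is dropped, and its slope lies in the dual unit ball.\<close>

lemma dual_functional_near_norm:
  fixes nrm :: "'a::euclidean_space \<Rightarrow> real"
  assumes n: "is_norm nrm" and m: "m < nrm u"
  obtains z where "\<And>v. z \<bullet> v \<le> nrm v" "m < z \<bullet> u"
proof -
  define E where "E = {(y, r). nrm y \<le> r}"
  have "E = epigraph UNIV nrm" by (auto simp: E_def epigraph_def)
  then have "convex E" using is_norm_convex[OF n] by (simp add: convex_epigraph)
  moreover have "closed E"
    unfolding E_def case_prod_beta
    by (intro closed_Collect_le continuous_on_snd continuous_on_id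
          continuous_on_compose2[OF is_norm_continuous[OF n] continuous_on_fst]) auto
  moreover have "(0, 0) \<in> E" "(0, - 1) \<notin> E" "(u, m) \<notin> E"
    using m by (auto simp: E_def is_norm_rules[OF n])
  ultimately obtain z \<beta> where z: "(z, \<beta>) \<in> conj_epi E" "m < z \<bullet> u - \<beta>"
    using affine_minorant_above[of E 0 0 "- 1" u m] by (auto simp: E_def)
  have min: "z \<bullet> v - \<beta> \<le> nrm v" for v
    using conj_epi_D[OF z(1)] by (auto simp: E_def)
  have "0 \<le> \<beta>" using min[of 0] by (simp add: is_norm_rules[OF n])
  have "z \<bullet> v \<le> nrm v" for v
  proof (rule ccontr)
    assume "\<not> z \<bullet> v \<le> nrm v"
    define d where "d = z \<bullet> v - nrm v"
    have "0 < d" using \<open>\<not> z \<bullet> v \<le> nrm v\<close> by (simp add: d_def)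
    define k where "k = (\<beta> + 1) / d"
    have k: "0 \<le> k" "k * d = \<beta> + 1" using \<open>0 < d\<close> \<open>0 \<le> \<beta>\<close> by (auto simp: k_def)
    have "k * (z \<bullet> v) - \<beta> \<le> k * nrm v"
      using min[of "k *\<^sub>R v"]  k(1) by (simp add: is_norm_rules[OF n])
    then show False using k(2) by (simp add: d_def right_diff_distrib)
  qed
  moreover have "m < z \<bullet> u" using z(2) \<open>0 \<le> \<beta>\<close> by simp
  ultimately show ?thesis using that by blast
qed

text \<open>Minimising \<open>\<langle>z, u\<rangle>\<close> over the dual ball of radius \<open>\<theta>\<close> yields \<open>-\<theta> \<parallel>u\<parallel>\<close>: a lower bound for all
  \<open>z\<close> in this ball turns into the transportation cost.\<close>

lemma le_minus_norm_if_dual_ball: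
  fixes nrm :: "'a::euclidean_space \<Rightarrow> real"
  assumes n: "is_norm nrm" and "0 \<le> \<theta>"
    and le: "\<And>z. (\<And>v. z \<bullet> v \<le> \<theta> * nrm v) \<Longrightarrow> c \<le> C + z \<bullet> u"
  shows "c \<le> C - \<theta> * nrm u"
proof (rule ccontr)
  assume not: "\<not> c \<le> C - \<theta> * nrm u"
  have "c \<le> C" using le[of 0] \<open>0 \<le> \<theta>\<close>  by (simp add: is_norm_rules[OF n])
  then have "0 < \<theta>" using not \<open>0 \<le> \<theta>\<close> by (cases "\<theta> = 0") auto
  have "(C - c) / \<theta> < nrm (- u)" using not \<open>0 < \<theta>\<close> by (simp add: is_norm_minus[OF n] field_simps)
  from dual_functional_near_norm[OF n this] obtain z
    where z: "\<And>v. z \<bullet> v \<le> nrm v" "(C - c) / \<theta> < z \<bullet> (- u)" by blast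
  have "c \<le> C + (\<theta> *\<^sub>R z) \<bullet> u" using z(1) \<open>0 \<le> \<theta>\<close> by (intro le) (simp add: mult_left_mono)
  moreover have "C - c < - \<theta> * (z \<bullet> u)" using z(2) \<open>0 < \<theta>\<close> by (simp add: field_simps)
  ultimately show False by simp
qed

lemma nonpos_if_bounded_multiples:
  fixes d :: real
  assumes "\<And>k. 0 \<le> k \<Longrightarrow> k * d \<le> M" shows "d \<le> 0"
proof (rule ccontr)
  assume "\<not> d \<le> 0"
  then have "0 < d" by simp
  have "(\<bar>M\<bar> + 1) / d * d \<le> M" using \<open>0 < d\<close> by (intro assms) auto
  then show False using \<open>0 < d\<close> by simp
qed

section \<open>Approximate strong duality\<close>

definition dual_ball :: "('a::real_inner \<Rightarrow> real) \<Rightarrow> real \<Rightarrow> 'a set" where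
  "dual_ball nrm \<theta> = {z. \<forall>v. z \<bullet> v \<le> \<theta> * nrm v}"

lemma convex_dual_ball: "convex (dual_ball nrm \<theta>)"
proof (rule convexI)
  fix x y :: 'a and a b :: real
  assume xy: "x \<in> dual_ball nrm \<theta>" "y \<in> dual_ball nrm \<theta>" and ab: "0 \<le> a" "0 \<le> b" "a + b = 1"
  have "(a *\<^sub>R x + b *\<^sub>R y) \<bullet> v \<le> \<theta> * nrm v" for v
  proof -
    have "a * (x \<bullet> v) + b * (y \<bullet> v) \<le> a * (\<theta> * nrm v) + b * (\<theta> * nrm v)"
      using xy ab by (intro add_mono mult_left_mono) (auto simp: dual_ball_def)
    also have "\<dots> = \<theta> * nrm v" using ab by (metis distrib_right mult_1)
    finally show ?thesis by (simp add: inner_add_left)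
  qed
  then show "a *\<^sub>R x + b *\<^sub>R y \<in> dual_ball nrm \<theta>" by (simp add: dual_ball_def)
qed

text \<open>The first component measures by how much \<open>z = w + v\<close> fails, the second is the dual value. A
  point \<open>(0, t)\<close> of this set is an exact certificate for \<open>t\<close> and \<open>\<theta>\<close>, where \<open>w\<close> stands for \<open>z - v\<close>.\<close>

definition certificate_values ::
  "('a::real_inner \<times> real) set \<Rightarrow> 'a set \<Rightarrow> ('a \<Rightarrow> real) \<Rightarrow> real \<Rightarrow> 'a \<Rightarrow> ('a \<times> real) set" where
  "certificate_values E A nrm \<theta> p =
     (\<lambda>((w, \<beta>), (v, b), z). (w + v - z, \<beta> + b - z \<bullet> p)) ` (conj_epi E \<times> supp_epi A \<times> dual_ball nrm \<theta>)"

lemma convex_certificate_values: "convex (certificate_values E A nrm \<theta> p)"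
proof -
  have "linear (\<lambda>((w, \<beta>), (v, b), z). (w + v - z, \<beta> + b - z \<bullet> p))"
    by (rule linearI) (auto simp: algebra_simps inner_add_left)
  then show ?thesis
    unfolding certificate_values_def
    by (intro convex_linear_image convex_Times convex_conj_epi convex_supp_epi convex_dual_ball)
qed

text \<open>If \<open>(0, t)\<close> were outside this closed convex set, a hyperplane with normal \<open>(-y, \<alpha>)\<close>, where
  \<open>\<alpha> \<ge> 0\<close>, would separate it strictly, and the normal would refute the primal bound. If \<open>\<alpha> > 0\<close>, the point
  \<open>y / \<alpha>\<close> lies in \<open>A\<close>, as the half-spaces containing \<open>A\<close> do not exclude it, and by Fenchel-Moreau the
  value \<open>g - \<theta> \<parallel>\<cdot> - p\<parallel>\<close> there exceeds \<open>t\<close>, where \<open>-g\<close> has the epigraph \<open>E\<close>. If \<open>\<alpha> = 0\<close>, then \<open>y\<close> is a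
  recession direction of \<open>A\<close> along which \<open>g\<close> grows by more than \<open>\<theta> \<parallel>y\<parallel>\<close> per unit, so that the same
  value is unbounded on the ray from \<open>y0\<close>.\<close>

lemma zero_in_closure_certificate_values:
  fixes E :: "('a::euclidean_space \<times> real) set"
  assumes E: "convex E" "closed E" and up: "\<forall>y r r'. (y, r) \<in> E \<longrightarrow> r \<le> r' \<longrightarrow> (y, r') \<in> E"
    and A: "convex A" "closed A" and e0: "(y0, r0) \<in> E" "y0 \<in> A"
    and n: "is_norm nrm" and \<theta>: "0 \<le> \<theta>"
    and bound: "\<And>y r. (y, r) \<in> E \<Longrightarrow> y \<in> A \<Longrightarrow> - r - \<theta> * nrm (y - p) \<le> t"
  shows "(0, t) \<in> closure (certificate_values E A nrm \<theta> p)"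
proof -
  let ?Z = "dual_ball nrm \<theta>"
  let ?D = "certificate_values E A nrm \<theta> p"
  have D_I: "(w + v - z, \<beta> + b - z \<bullet> p) \<in> ?D"
    if "(w, \<beta>) \<in> conj_epi E" "(v, b) \<in> supp_epi A" "z \<in> ?Z" for w \<beta> v b z
    unfolding certificate_values_def
    using that by (force intro: image_eqI[of _ _ "((w, \<beta>), (v, b), z)"])
  have z0: "0 \<in> ?Z" using \<theta> by (simp add: dual_ball_def is_norm_rules[OF n])
  have v0: "(0, 0) \<in> supp_epi A" by (simp add: supp_epi_def)
  have novert: "(y0, - (t + \<theta> * nrm (y0 - p) + 1)) \<notin> E" using bound[OF _ e0(2)] by force
  note minorant = affine_minorant_above[OF E up e0(1) novert]
  obtain w0 \<beta>0 where w0: "(w0, \<beta>0) \<in> conj_epi E" using minorant[OF novert] by metis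
  show ?thesis
  proof (rule ccontr)
    assume out: "(0, t) \<notin> closure ?D"
    obtain q c where q: "q \<bullet> (0, t) < c" "\<forall>x\<in>closure ?D. c < q \<bullet> x"
      using separating_hyperplane_closed_point[OF convex_closure[OF convex_certificate_values] closed_closure out]
      by blast
    obtain y \<alpha> where qy: "q = (- y, \<alpha>)" by (metis minus_minus surj_pair)
    have t: "\<alpha> * t < c" using q(1) by (simp add: qy)
    have sep: "c \<le> \<alpha> * (\<beta> + b - z \<bullet> p) - y \<bullet> (w + v - z)"
      if "(w, \<beta>) \<in> conj_epi E" "(v, b) \<in> supp_epi A" "z \<in> ?Z" for w \<beta> v b z
      using bspec[OF q(2) subsetD[OF closure_subset D_I[OF that]]] by (simp add: qy)
    \<comment> \<open>Each of the three sets is exploited separately: \<open>\<beta>\<close> can be raised without limit, half-spaces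
      can be scaled without limit, and \<open>z\<close> ranges over the whole dual ball.\<close>
    have "- \<alpha> \<le> 0"
    proof (rule nonpos_if_bounded_multiples)
      fix k :: real assume "0 \<le> k"
      then have "(w0, \<beta>0 + k) \<in> conj_epi E" using w0 by (fastforce simp: conj_epi_def)
      from sep[OF this v0 z0] show "k * - \<alpha> \<le> \<alpha> * \<beta>0 - y \<bullet> w0 - c" by (simp add: algebra_simps)
    qed
    have sepv: "v \<bullet> y - \<alpha> * b \<le> 0" if "(v, b) \<in> supp_epi A" for v b
    proof (rule nonpos_if_bounded_multiples)
      fix k :: real assume "0 \<le> k"
      from sep[OF w0 supp_epi_scale[OF that this] z0]
      show "k * (v \<bullet> y - \<alpha> * b) \<le> \<alpha> * \<beta>0 - y \<bullet> w0 - c"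
        by (simp add: algebra_simps inner_commute)
    qed
    have sepw: "c \<le> \<alpha> * \<beta> - w \<bullet> y - \<theta> * nrm (y - \<alpha> *\<^sub>R p)" if "(w, \<beta>) \<in> conj_epi E" for w \<beta>
    proof (rule le_minus_norm_if_dual_ball[OF n \<theta>])
      fix z assume "\<And>v. z \<bullet> v \<le> \<theta> * nrm v"
      then have "z \<in> ?Z" by (simp add: dual_ball_def)
      from sep[OF that v0 this] show "c \<le> \<alpha> * \<beta> - w \<bullet> y + z \<bullet> (y - \<alpha> *\<^sub>R p)"
        by (simp add: algebra_simps inner_commute)
    qed
    show False
    proof (cases "\<alpha> = 0")
      case False
      then have \<alpha>: "0 < \<alpha>" using \<open>- \<alpha> \<le> 0\<close> by simp
      define y1 where "y1 = y /\<^sub>R \<alpha>"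
      have y: "y = \<alpha> *\<^sub>R y1" using \<alpha> by (simp add: y1_def)
      have "y1 \<in> A"
      proof (rule ccontr)
        assume "y1 \<notin> A"
        from supp_epi_separates[OF A this] obtain v b
          where vb: "(v, b) \<in> supp_epi A" "b < v \<bullet> y1" by blast
        then show False using sepv[OF vb(1)] \<alpha> by (simp add: y)
      qed
      have "nrm (y - \<alpha> *\<^sub>R p) = \<alpha> * nrm (y1 - p)"
        using n \<alpha> by (metis abs_of_pos is_norm_scaleR scaleR_right_diff_distrib y)
      then have w: "c \<le> \<alpha> * (\<beta> - w \<bullet> y1 - \<theta> * nrm (y1 - p))" if "(w, \<beta>) \<in> conj_epi E" for w \<beta>
        using sepw[OF that] by (simp add: y algebra_simps)
      have "(y1, - (c / \<alpha> + \<theta> * nrm (y1 - p))) \<in> E"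
      proof (rule ccontr)
        assume "(y1, - (c / \<alpha> + \<theta> * nrm (y1 - p))) \<notin> E"
        from minorant[OF this] obtain w' \<beta> where *: "(w', \<beta>) \<in> conj_epi E"
          "- (c / \<alpha> + \<theta> * nrm (y1 - p)) < w' \<bullet> y1 - \<beta>" by metis
        then have "\<beta> - w' \<bullet> y1 - \<theta> * nrm (y1 - p) < c / \<alpha>" by simp
        then have "\<alpha> * (\<beta> - w' \<bullet> y1 - \<theta> * nrm (y1 - p)) < c" using \<alpha> by (simp add: field_simps)
        then show False using w[OF *(1)] by simp
      qed
      from bound[OF this \<open>y1 \<in> A\<close>] have "c / \<alpha> \<le> t" by simp
      then show False using t \<alpha> by (simp add: field_simps)
    next
      case True
      have "0 < c" using t True by simp
      have "c \<le> 0"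
      proof (rule nonpos_if_bounded_multiples)
        fix k :: real assume k: "0 \<le> k"
        have "y0 + k *\<^sub>R y \<in> A"
        proof (rule ccontr)
          assume "y0 + k *\<^sub>R y \<notin> A"
          from supp_epi_separates[OF A this] obtain v b
            where vb: "(v, b) \<in> supp_epi A" "b < v \<bullet> (y0 + k *\<^sub>R y)" by blast
          have "v \<bullet> y0 \<le> b" using vb(1) e0(2) by (auto simp: supp_epi_def)
          moreover have "k * (v \<bullet> y) \<le> 0" using sepv[OF vb(1)] True k by (simp add: mult_le_0_iff)
          ultimately show False using vb(2) by (simp add: inner_add_right)
        qed
        moreover have "(y0 + k *\<^sub>R y, r0 - k * (c + \<theta> * nrm y)) \<in> E"
        proof (rule ccontr)
          assume "(y0 + k *\<^sub>R y, r0 - k * (c + \<theta> * nrm y)) \<notin> E"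
          from minorant[OF this] obtain w' \<beta> where *: "(w', \<beta>) \<in> conj_epi E"
            "r0 - k * (c + \<theta> * nrm y) < w' \<bullet> (y0 + k *\<^sub>R y) - \<beta>" by metis
          have "w' \<bullet> y0 - \<beta> \<le> r0" using conj_epi_D[OF *(1) e0(1)] .
          moreover have "k * (w' \<bullet> y) \<le> k * (- (c + \<theta> * nrm y))"
            using sepw[OF *(1)] True k by (intro mult_left_mono) auto
          ultimately show False using *(2) by (simp add: inner_add_right algebra_simps)
        qed
        ultimately have 1: "k * (c + \<theta> * nrm y) - r0 - \<theta> * nrm (y0 + k *\<^sub>R y - p) \<le> t"
          using bound by force
        have "nrm (k *\<^sub>R y) = k * nrm y" using k by (simp add: is_norm_rules[OF n])
        moreover have "nrm ((y0 - p) + k *\<^sub>R y) \<le> nrm (y0 - p) + nrm (k *\<^sub>R y)"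
          by (rule is_norm_triangle[OF n])
        ultimately have "nrm (y0 + k *\<^sub>R y - p) \<le> nrm (y0 - p) + k * nrm y"
          by (simp add: algebra_simps)
        from mult_left_mono[OF this \<theta>] 1
        show "k * c \<le> t + r0 + \<theta> * nrm (y0 - p)" by (simp add: algebra_simps)
      qed
      then show False using \<open>0 < c\<close> by simp
    qed
  qed
qed

text \<open>The points of \<open>certificate_values\<close> close to \<open>(0, t)\<close> satisfy \<open>z = w + v\<close> only up to a small error;
  putting \<open>w + v\<close> in the place of \<open>z\<close> removes the error at the cost of \<open>\<delta>\<close> in both bounds.\<close>

lemma approximate_dual_certificate:
  fixes E :: "('a::euclidean_space \<times> real) set"
  assumes E: "convex E" "closed E" and up: "\<forall>y r r'. (y, r) \<in> E \<longrightarrow> r \<le> r' \<longrightarrow> (y, r') \<in> E"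
    and A: "convex A" "closed A" and e0: "(y0, r0) \<in> E" "y0 \<in> A"
    and n: "is_norm nrm" and \<theta>: "0 \<le> \<theta>"
    and bound: "\<And>y r. (y, r) \<in> E \<Longrightarrow> y \<in> A \<Longrightarrow> - r - \<theta> * nrm (y - p) \<le> t"
    and \<delta>: "0 < \<delta>"
  obtains w \<beta> v b where "(w, \<beta>) \<in> conj_epi E" "(v, b) \<in> supp_epi A"
    "dual_norm nrm (w + v) \<le> \<theta> + \<delta>" "\<beta> + b - (w + v) \<bullet> p \<le> t + \<delta>"
proof -
  have mem_closure: "(0, t) \<in> closure (certificate_values E A nrm \<theta> p)"
    by (rule zero_in_closure_certificate_values[OF E up A e0 n \<theta> bound])
  obtain B where B: "0 < B" "\<And>v. norm v \<le> B * nrm v" using is_norm_dominates_norm[OF n] by metis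
  \<comment> \<open>An error \<open>e\<close> with \<open>norm e < \<gamma>\<close> in the first component is absorbed into \<open>z\<close>. It changes the
    dual norm of \<open>z\<close> by at most \<open>\<gamma> B\<close> and \<open>\<langle>z, p\<rangle>\<close> by at most \<open>\<gamma> * norm p\<close>; the error in the second
    component adds another \<open>\<gamma>\<close>.\<close>
  define \<gamma> where "\<gamma> = min (\<delta> / B) (\<delta> / (1 + norm p))"
  have \<gamma>: "0 < \<gamma>" "\<gamma> * B \<le> \<delta>" "\<gamma> * (1 + norm p) \<le> \<delta>"
  proof -
    show "0 < \<gamma>" using B \<delta> by (simp add: \<gamma>_def add_pos_nonneg)
    show "\<gamma> * B \<le> \<delta>" using B \<delta> by (simp add: \<gamma>_def flip: pos_le_divide_eq)
    have "0 < 1 + norm p" by (simp add: add_pos_nonneg)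
    then show "\<gamma> * (1 + norm p) \<le> \<delta>" by (simp add: \<gamma>_def flip: pos_le_divide_eq)
  qed
  from mem_closure \<gamma>(1) obtain d where d: "d \<in> certificate_values E A nrm \<theta> p" "dist d (0, t) < \<gamma>"
    unfolding closure_approachable by blast
  then obtain w \<beta> v b z where mem: "(w, \<beta>) \<in> conj_epi E" "(v, b) \<in> supp_epi A" "z \<in> dual_ball nrm \<theta>"
    and deq: "d = (w + v - z, \<beta> + b - z \<bullet> p)" by (auto simp: certificate_values_def)
  define e where "e = w + v - z"
  have "norm e < \<gamma>" "\<bar>\<beta> + b - z \<bullet> p - t\<bar> < \<gamma>"
    using d(2) dist_fst_le[of d "(0, t)"] dist_snd_le[of d "(0, t)"]
    by (auto simp: deq e_def dist_norm)
  have wv: "w + v = z + e" by (simp add: e_def)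
  have "(w + v) \<bullet> u \<le> (\<theta> + \<delta>) * nrm u" for u
  proof -
    have "0 \<le> nrm u" by (simp add: is_norm_rules[OF n])
    have "e \<bullet> u \<le> norm e * norm u" by (rule norm_cauchy_schwarz)
    also have "\<dots> \<le> \<gamma> * (B * nrm u)"
      using \<open>norm e < \<gamma>\<close> B(2)[of u] \<gamma>(1) by (intro mult_mono) auto
    also have "\<dots> \<le> \<delta> * nrm u"
      using mult_right_mono[OF \<gamma>(2) \<open>0 \<le> nrm u\<close>] by (simp add: mult.assoc)
    finally show ?thesis using mem(3) unfolding wv dual_ball_def
      by (simp add: inner_add_left distrib_right add_mono)
  qed
  then have "dual_norm nrm (w + v) \<le> \<theta> + \<delta>" using dual_norm_le_iff[OF n] \<theta> \<delta> by simp
  moreover have "\<beta> + b - (w + v) \<bullet> p \<le> t + \<delta>"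
  proof -
    have "- (e \<bullet> p) \<le> norm e * norm p" using norm_cauchy_schwarz[of "- e" p] by simp
    also have "\<dots> \<le> \<gamma> * norm p" using \<open>norm e < \<gamma>\<close> by (intro mult_right_mono) auto
    finally show ?thesis
      using \<open>\<bar>\<beta> + b - z \<bullet> p - t\<bar> < \<gamma>\<close> \<gamma>(3) unfolding wv by (simp add: inner_add_left algebra_simps)
  qed
  ultimately show ?thesis using that mem by blast
qed

section \<open>Extended-valued functions\<close>

text \<open>The epigraph of \<open>-g\<close>, written as the mirror image of the hypograph that defines concavity.\<close>

definition epi_neg :: "('a \<Rightarrow> ereal) \<Rightarrow> ('a \<times> real) set" where
  "epi_neg g = {(y, r). ereal (- r) \<le> g y}"

lemma epi_neg_upward: "(y, r) \<in> epi_neg g \<Longrightarrow> r \<le> r' \<Longrightarrow> (y, r') \<in> epi_neg g"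
  by (auto simp: epi_neg_def intro: order_trans[rotated])

lemma convex_epi_neg:
  assumes "concave_fun g" shows "convex (epi_neg g)"
proof -
  have "linear (\<lambda>p::'a \<times> real. (fst p, - snd p))"
    by (rule linearI) auto
  moreover have "epi_neg g = (\<lambda>p. (fst p, - snd p)) -` {(y, r). ereal r \<le> g y}"
    by (auto simp: epi_neg_def)
  ultimately show ?thesis
    using assms convex_linear_vimage[of "\<lambda>p::'a \<times> real. (fst p, - snd p)"]
    unfolding concave_fun_def by metis
qed

lemma closed_epi_neg:
  fixes g :: "'a::topological_space \<Rightarrow> ereal"
  assumes "usc_fun g" shows "closed (epi_neg g)"
proof -
  have "\<exists>S. open S \<and> (y, r) \<in> S \<and> S \<subseteq> - epi_neg g" if "(y, r) \<notin> epi_neg g" for y r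
  proof -
    have "g y < ereal (- r)" using that by (simp add: epi_neg_def not_le)
    then obtain c where c: "g y < ereal c" "c < - r" using ereal_dense2 by force
    then have "\<forall>\<^sub>F y' in nhds y. g y' < ereal c" using assms by (simp add: usc_fun_def)
    then obtain U where U: "open U" "y \<in> U" "\<And>y'. y' \<in> U \<Longrightarrow> g y' < ereal c"
      by (auto simp: eventually_nhds)
    have "U \<times> {..< - c} \<subseteq> - epi_neg g"
    proof safe
      fix y' r' assume "y' \<in> U" "r' < - c" "(y', r') \<in> epi_neg g"
      then have "ereal (- r') \<le> g y'" by (simp add: epi_neg_def)
      also have "g y' < ereal c" using U(3) \<open>y' \<in> U\<close> .
      finally have "ereal (- r') < ereal c" .
      then show False using \<open>r' < - c\<close> by simp
    qed
    then show ?thesis using U c by (intro exI[of _ "U \<times> {..< - c}"]) (auto intro: open_Times)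
  qed
  then have "open (- epi_neg g)" by (subst open_subopen) auto
  then show ?thesis by (simp add: closed_def)
qed

lemma convex_conjugate_le_iff:
  assumes "\<And>\<xi>. g \<xi> \<noteq> \<infinity>"
  shows "convex_conjugate (\<lambda>\<xi>. - g \<xi>) w \<le> ereal \<beta> \<longleftrightarrow> (w, \<beta>) \<in> conj_epi (epi_neg g)"
proof -
  have "ereal (w \<bullet> \<xi>) - (- g \<xi>) \<le> ereal \<beta> \<longleftrightarrow> (\<forall>r. ereal (- r) \<le> g \<xi> \<longrightarrow> w \<bullet> \<xi> - \<beta> \<le> r)" for \<xi>
  proof (cases "g \<xi>")
    case (real \<gamma>)
    have "w \<bullet> \<xi> + \<gamma> \<le> \<beta> \<longleftrightarrow> (\<forall>r. - r \<le> \<gamma> \<longrightarrow> w \<bullet> \<xi> - \<beta> \<le> r)"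
      by (auto dest: spec[of _ "- \<gamma>"])
    then show ?thesis by (simp add: real)
  qed (use assms in auto)
  then show ?thesis
    by (simp add: convex_conjugate_def SUP_le_iff conj_epi_def epi_neg_def)
qed

lemma support_fun_le_iff: "support_fun A v \<le> ereal b \<longleftrightarrow> (v, b) \<in> supp_epi A"
  by (simp add: support_fun_def SUP_le_iff supp_epi_def)

text \<open>Sums of opposite infinities do no harm here: they have the value \<open>\<infinity>\<close>, and a term equal
  to \<open>\<infinity>\<close> has no real upper bound.\<close>

lemma ereal_sum_le_split:
  fixes x y :: ereal
  shows "x + y - ereal c \<le> ereal t \<longleftrightarrow> (\<exists>a b. x \<le> ereal a \<and> y \<le> ereal b \<and> a + b - c \<le> t)"
proof
  assume le: "x + y - ereal c \<le> ereal t"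
  show "\<exists>a b. x \<le> ereal a \<and> y \<le> ereal b \<and> a + b - c \<le> t"
  proof (cases x; cases y)
    fix a assume "x = ereal a" "y = - \<infinity>"
    then show ?thesis by (intro exI[of _ a] exI[of _ "t + c - a"]) simp
  next
    fix b assume "x = - \<infinity>" "y = ereal b"
    then show ?thesis by (intro exI[of _ "t + c - b"] exI[of _ b]) simp
  next
    assume "x = - \<infinity>" "y = - \<infinity>"
    then show ?thesis by (intro exI[of _ t] exI[of _ c]) simp
  qed (use le in auto)
next
  assume "\<exists>a b. x \<le> ereal a \<and> y \<le> ereal b \<and> a + b - c \<le> t"
  then show "x + y - ereal c \<le> ereal t" by (cases x; cases y) auto
qed

text \<open>The constraint of the second problem for one triple \<open>(i, j, k)\<close>, with the conjugate and the
  support function replaced by real upper bounds \<open>\<beta>\<close> and \<open>b\<close>.\<close>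

definition dual_certificate ::
  "('a::real_inner \<Rightarrow> ereal) \<Rightarrow> 'a set \<Rightarrow> 'a \<Rightarrow> real \<Rightarrow> 'a \<Rightarrow> 'a \<Rightarrow> bool" where
  "dual_certificate g A p t z v \<longleftrightarrow>
     (\<exists>\<beta> b. (z - v, \<beta>) \<in> conj_epi (epi_neg g) \<and> (v, b) \<in> supp_epi A \<and> \<beta> + b - z \<bullet> p \<le> t)"

lemma conjugate_constraint_iff:
  assumes "\<And>\<xi>. g \<xi> \<noteq> \<infinity>"
  shows "convex_conjugate (\<lambda>\<xi>. - g \<xi>) (z - v) + support_fun A v - ereal (z \<bullet> p) \<le> ereal t
         \<longleftrightarrow> dual_certificate g A p t z v"
  unfolding ereal_sum_le_split dual_certificate_def support_fun_le_iff
    convex_conjugate_le_iff[of g, OF assms] ..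

text \<open>Adding the two inequalities of Fenchel-Young type that \<open>\<beta>\<close> and \<open>b\<close> provide at \<open>y\<close> cancels \<open>v\<close> and
  leaves \<open>g y + \<langle>z, y - p\<rangle> \<le> t\<close>.\<close>

lemma dual_certificate_weak_duality:
  assumes n: "is_norm nrm" and \<theta>: "0 \<le> \<theta>" and fin: "g y \<noteq> \<infinity>" and y: "y \<in> A"
    and z: "dual_norm nrm z \<le> \<theta>" and cert: "dual_certificate g A p t z v"
  shows "g y - ereal (\<theta> * nrm (y - p)) \<le> ereal t"
proof (cases "g y")
  case (real \<gamma>)
  obtain \<beta> b where \<beta>: "(z - v, \<beta>) \<in> conj_epi (epi_neg g)" and b: "(v, b) \<in> supp_epi A"
    and t: "\<beta> + b - z \<bullet> p \<le> t" using cert by (auto simp: dual_certificate_def)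
  have "(z - v) \<bullet> y - \<beta> \<le> - \<gamma>" using conj_epi_D[OF \<beta>] by (simp add: epi_neg_def real)
  moreover have "v \<bullet> y \<le> b" using b y by (simp add: supp_epi_def)
  moreover have "z \<bullet> (- (y - p)) \<le> \<theta> * nrm (y - p)"
    using z dual_norm_le_iff[OF n \<theta>] is_norm_minus[OF n] by metis
  ultimately show ?thesis using t by (simp add: real algebra_simps inner_diff_left inner_diff_right)
qed (use fin in auto)

lemma dual_certificate_near_primal_bound:
  fixes g :: "'a::euclidean_space \<Rightarrow> ereal"
  assumes g: "concave_fun g" "usc_fun g" "\<And>\<xi>. g \<xi> \<noteq> \<infinity>" and A: "convex A" "closed A"
    and y0: "y0 \<in> A" "g y0 \<noteq> - \<infinity>"
    and n: "is_norm nrm" and \<theta>: "0 \<le> \<theta>" and \<delta>: "0 < \<delta>"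
    and bound: "\<And>y. y \<in> A \<Longrightarrow> g y - ereal (\<theta> * nrm (y - p)) \<le> ereal t"
  shows "\<exists>z v. dual_certificate g A p (t + \<delta>) z v \<and> dual_norm nrm z \<le> \<theta> + \<delta>"
proof -
  obtain \<gamma> where "g y0 = ereal \<gamma>" using y0(2) g(3) by (cases "g y0") auto
  then have e0: "(y0, - \<gamma>) \<in> epi_neg g" by (simp add: epi_neg_def)
  have up: "\<forall>y r r'. (y, r) \<in> epi_neg g \<longrightarrow> r \<le> r' \<longrightarrow> (y, r') \<in> epi_neg g"
    using epi_neg_upward by metis
  have "- r - \<theta> * nrm (y - p) \<le> t" if "(y, r) \<in> epi_neg g" "y \<in> A" for y r
  proof -
    have "ereal (- r) \<le> g y" using that(1) by (simp add: epi_neg_def)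
    then have "ereal (- r) - ereal (\<theta> * nrm (y - p)) \<le> g y - ereal (\<theta> * nrm (y - p))"
      by (rule ereal_minus_mono) simp
    also note bound[OF that(2)]
    finally show ?thesis by simp
  qed
  from approximate_dual_certificate[OF convex_epi_neg[OF g(1)] closed_epi_neg[OF g(2)] up A e0 y0(1) n \<theta> this \<delta>]
  obtain w \<beta> v b where c: "(w, \<beta>) \<in> conj_epi (epi_neg g)" "(v, b) \<in> supp_epi A"
    "dual_norm nrm (w + v) \<le> \<theta> + \<delta>" "\<beta> + b - (w + v) \<bullet> p \<le> t + \<delta>" by metis
  then have "dual_certificate g A p (t + \<delta>) (w + v) v"
    unfolding dual_certificate_def add_diff_cancel_right' by blast
  then show ?thesis using c(3) by blast
qed

lemma dual_certificate_convex_combination: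
  assumes c: "dual_certificate g A p t z v" "dual_certificate g A p t' z' v'"
    and ab: "0 \<le> a" "0 \<le> b" "a + b = 1"
  shows "dual_certificate g A p (a * t + b * t') (a *\<^sub>R z + b *\<^sub>R z') (a *\<^sub>R v + b *\<^sub>R v')"
proof -
  obtain \<beta> c where 1: "(z - v, \<beta>) \<in> conj_epi (epi_neg g)" "(v, c) \<in> supp_epi A" "\<beta> + c - z \<bullet> p \<le> t"
    using c(1) by (auto simp: dual_certificate_def)
  obtain \<beta>' c' where 2: "(z' - v', \<beta>') \<in> conj_epi (epi_neg g)" "(v', c') \<in> supp_epi A"
    "\<beta>' + c' - z' \<bullet> p \<le> t'"
    using c(2) by (auto simp: dual_certificate_def)
  have "a *\<^sub>R (z - v, \<beta>) + b *\<^sub>R (z' - v', \<beta>') \<in> conj_epi (epi_neg g)"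
    using convex_conj_epi 1(1) 2(1) ab by (rule convexD)
  then have "(a *\<^sub>R z + b *\<^sub>R z' - (a *\<^sub>R v + b *\<^sub>R v'), a * \<beta> + b * \<beta>') \<in> conj_epi (epi_neg g)"
    by (simp add: algebra_simps)
  moreover have "a *\<^sub>R (v, c) + b *\<^sub>R (v', c') \<in> supp_epi A"
    using convex_supp_epi 1(2) 2(2) ab by (rule convexD)
  then have "(a *\<^sub>R v + b *\<^sub>R v', a * c + b * c') \<in> supp_epi A" by simp
  moreover have "a * (\<beta> + c - z \<bullet> p) + b * (\<beta>' + c' - z' \<bullet> p) \<le> a * t + b * t'"
    using 1(3) 2(3) ab by (intro add_mono mult_left_mono)
  then have "a * \<beta> + b * \<beta>' + (a * c + b * c') - (a *\<^sub>R z + b *\<^sub>R z') \<bullet> p \<le> a * t + b * t'"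
    by (simp add: algebra_simps inner_add_left)
  ultimately show ?thesis unfolding dual_certificate_def by blast
qed

lemma dual_norm_convex_combination:
  fixes nrm :: "'a::euclidean_space \<Rightarrow> real"
  assumes n: "is_norm nrm" and c: "0 \<le> c" "0 \<le> c'" and le: "dual_norm nrm u \<le> c" "dual_norm nrm u' \<le> c'"
    and ab: "0 \<le> a" "0 \<le> b"
  shows "dual_norm nrm (a *\<^sub>R u + b *\<^sub>R u') \<le> a * c + b * c'"
proof -
  have "a * (u \<bullet> v) + b * (u' \<bullet> v) \<le> a * (c * nrm v) + b * (c' * nrm v)" for v
    using le ab dual_norm_le_iff[OF n c(1)] dual_norm_le_iff[OF n c(2)]
    by (intro add_mono mult_left_mono) auto
  then show ?thesis
    using c ab by (subst dual_norm_le_iff[OF n]) (auto simp: inner_add_left algebra_simps)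
qed

section \<open>The two problems\<close>

text \<open>Regions without samples count one point, so the averages below are never over an empty range.\<close>

lemma num_points_pos: "0 < num_points N reg i"
  by (auto simp: num_points_def empty_regions_def region_samples_def card_gt_0_iff)

text \<open>This invariance is what makes the approximate certificates harmless: raising all \<open>t\<close> by \<open>\<delta>\<close> can
  be compensated by \<open>\<eta>\<close>, without touching \<open>\<lambda>\<close>.\<close>

lemma slack_vec_shift:
  assumes "\<And>i. 0 < M i"
  shows "slack_vec M mu (eta + \<delta>) q (\<lambda>i j. t i j + \<delta>) = slack_vec M mu eta q t"
  using assms by (simp add: vec_eq_iff slack_vec_def sum.distrib add_divide_distrib less_imp_neq)

lemma slack_vec_linear_combination:
  "slack_vec M (a *\<^sub>R mu + b *\<^sub>R mu') (a * eta + b * eta') (a *\<^sub>R q + b *\<^sub>R q')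
           (\<lambda>i j. a * t i j + b * t' i j)
         = a *\<^sub>R slack_vec M mu eta q t + b *\<^sub>R slack_vec M mu' eta' q' t'"
  by (simp add: vec_eq_iff slack_vec_def sum.distrib add_divide_distrib algebra_simps
      flip: sum_distrib_left)

lemma objective_linear_combination:
  "objective \<rho> \<epsilon> M ph (a * lam + b * lam') (a *\<^sub>R mu + b *\<^sub>R mu') (a * eta + b * eta')
           (a *\<^sub>R q + b *\<^sub>R q') (a * theta + b * theta') (\<lambda>i j. a * t i j + b * t' i j)
         = a * objective \<rho> \<epsilon> M ph lam mu eta q theta t
           + b * objective \<rho> \<epsilon> M ph lam' mu' eta' q' theta' t'"
  unfolding objective_def slack_vec_linear_combination
  by (simp add: sum.distrib sum_distrib_left algebra_simps)

lemma common_constraints_convex_combination: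
  assumes n: "is_norm nrmP" and ab: "0 \<le> a" "0 \<le> b" "a + b = 1"
    and c: "common_constraints nrmP C M lam mu eta q theta t"
      "common_constraints nrmP C M lam' mu' eta' q' theta' t'"
  shows "common_constraints nrmP C M (a * lam + b * lam') (a *\<^sub>R mu + b *\<^sub>R mu')
           (a * eta + b * eta') (a *\<^sub>R q + b *\<^sub>R q') (a * theta + b * theta')
           (\<lambda>i j. a * t i j + b * t' i j)"
  using c ab unfolding common_constraints_def slack_vec_linear_combination
  by (auto simp: dual_cone_def inner_add_left intro!: dual_norm_convex_combination[OF n])

theorem theorem2:
  fixes X :: "(real^'n) set"
    and Xi_supp :: "(real^'d) set"
    and Xi :: "'i::finite \<Rightarrow> (real^'d) set"
    and f :: "real^'n \<Rightarrow> real^'d \<Rightarrow> ereal"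
    and K :: nat
    and g :: "nat \<Rightarrow> real^'n \<Rightarrow> real^'d \<Rightarrow> ereal"
    and \<rho> \<epsilon> :: real
    and N :: nat
    and s :: "nat \<Rightarrow> real^'d"
    and reg :: "nat \<Rightarrow> 'i"
    and worst :: "real^'n \<Rightarrow> 'i \<Rightarrow> real^'d"
    and C :: "(real^'i) set"
    and nrm :: "real^'d \<Rightarrow> real"
    and nrmP :: "real^'i \<Rightarrow> real"
  assumes "\<rho> \<ge> 0" and "\<epsilon> \<ge> 0"
    and "(\<Union>i. Xi i) = Xi_supp"
    and "\<forall>i i'. i \<noteq> i' \<longrightarrow> interior (Xi i) \<inter> interior (Xi i') = {}"
    and "\<forall>i. closed (Xi i) \<and> convex (Xi i)"
    and "\<forall>l\<in>{1..N}. s l \<in> Xi (reg l)"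
    and "\<forall>x\<in>X. \<forall>i\<in>empty_regions N reg. is_arg_max (f x) (\<lambda>\<xi>. \<xi> \<in> Xi i) (worst x i)"
    and "proper_cone C"
    and "is_norm nrm" and "is_norm nrmP"
    and "K \<ge> 1"
    and "\<forall>x\<in>X. \<forall>\<xi>. f x \<xi> = Max ((\<lambda>k. g k x \<xi>) ` {1..K})"
    and "\<forall>x\<in>X. \<forall>k\<in>{1..K}. proper_fun (\<lambda>\<xi>. - g k x \<xi>) \<and> concave_fun (g k x) \<and> usc_fun (g k x)"
    and "\<forall>x\<in>X. \<forall>k\<in>{1..K}. \<forall>i. \<exists>\<xi>\<in>Xi i. - g k x \<xi> \<noteq> \<infinity>"
  shows "P1_value \<rho> \<epsilon> (p_hat N reg) X f Xi nrm nrmP C (num_points N reg) (xi_hat s worst N reg)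
         = P1'_value \<rho> \<epsilon> (p_hat N reg) X K g Xi nrm nrmP C (num_points N reg) (xi_hat s worst N reg)
       \<and> (\<forall>x\<in>X. P1'_convex_at \<rho> \<epsilon> (p_hat N reg) X K g Xi nrm nrmP C (num_points N reg)
                   (xi_hat s worst N reg) x)"
proof -
  let ?M = "num_points N reg" and ?ph = "p_hat N reg" and ?xh = "xi_hat s worst N reg"
  note n = \<open>is_norm nrm\<close> and nP = \<open>is_norm nrmP\<close>
  have g_fin: "g k x \<xi> \<noteq> \<infinity>" if "x \<in> X" "k \<in> {1..K}" for x k \<xi>
    using assms(13) that unfolding proper_fun_def by (metis less_irrefl)
  have g_pt: "\<exists>y\<in>Xi i. g k x y \<noteq> - \<infinity>" if "x \<in> X" "k \<in> {1..K}" for x k i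
    using assms(14) that by (metis ereal_uminus_eq_reorder)
  have f_le: "f x \<xi> - ereal c \<le> ereal r \<longleftrightarrow> (\<forall>k\<in>{1..K}. g k x \<xi> - ereal c \<le> ereal r)"
    if "x \<in> X" for x \<xi> c r
  proof -
    have "f x \<xi> \<le> ereal (r + c) \<longleftrightarrow> (\<forall>k\<in>{1..K}. g k x \<xi> \<le> ereal (r + c))"
      using assms(12) that \<open>K \<ge> 1\<close> by (simp add: Max_le_iff)
    then show ?thesis by (simp add: ereal_minus_le)
  qed
  have P1: "P1_feasible X f Xi nrm nrmP C ?M ?xh x lam mu eta q theta t \<longleftrightarrow>
      x \<in> X \<and> common_constraints nrmP C ?M lam mu eta q theta t \<and>
      (\<forall>i. \<forall>j\<in>{1..?M i}. \<forall>k\<in>{1..K}. \<forall>y\<in>Xi i.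
         g k x y - ereal (theta * nrm (y - ?xh x i j)) \<le> ereal (t i j))"
    for x lam mu eta q theta t
    unfolding P1_feasible_def SUP_le_iff using f_le by blast
  have P1': "P1'_feasible X K g Xi nrm nrmP C ?M ?xh x lam mu eta q z v theta t \<longleftrightarrow>
      x \<in> X \<and> common_constraints nrmP C ?M lam mu eta q theta t \<and>
      (\<forall>i. \<forall>j\<in>{1..?M i}. \<forall>k\<in>{1..K}.
         dual_certificate (g k x) (Xi i) (?xh x i j) (t i j) (z i j k) (v i j k) \<and>
         dual_norm nrm (z i j k) \<le> theta)"
    for x lam mu eta q z v theta t
  proof -
    have "convex_conjugate (\<lambda>\<xi>. - g k x \<xi>) (z i j k - v i j k) + support_fun (Xi i) (v i j k)
          - ereal (z i j k \<bullet> ?xh x i j) \<le> ereal (t i j)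
        \<longleftrightarrow> dual_certificate (g k x) (Xi i) (?xh x i j) (t i j) (z i j k) (v i j k)"
      if x: "x \<in> X" "k \<in> {1..K}" for i j k
      by (rule conjugate_constraint_iff) (rule g_fin[OF x])
    then show ?thesis unfolding P1'_feasible_def by blast
  qed
  have sound: "P1_feasible X f Xi nrm nrmP C ?M ?xh x lam mu eta q theta t"
    if "P1'_feasible X K g Xi nrm nrmP C ?M ?xh x lam mu eta q z v theta t"
    for x lam mu eta q z v theta t
  proof -
    have x: "x \<in> X" and cc: "common_constraints nrmP C ?M lam mu eta q theta t"
      and c: "\<And>i j k. j \<in> {1..?M i} \<Longrightarrow> k \<in> {1..K} \<Longrightarrow>
         dual_certificate (g k x) (Xi i) (?xh x i j) (t i j) (z i j k) (v i j k)
         \<and> dual_norm nrm (z i j k) \<le> theta"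
      using that unfolding P1' by auto
    have "0 \<le> theta" using cc by (simp add: common_constraints_def)
    then show ?thesis
      unfolding P1 using x cc c g_fin dual_certificate_weak_duality[OF n] by blast
  qed
  have complete: "\<exists>z v. P1'_feasible X K g Xi nrm nrmP C ?M ?xh x lam mu (eta + \<delta>) q z v
      (theta + \<delta>) (\<lambda>i j. t i j + \<delta>)"
    if feas: "P1_feasible X f Xi nrm nrmP C ?M ?xh x lam mu eta q theta t" and \<delta>: "0 < \<delta>"
    for x lam mu eta q theta t \<delta>
  proof -
    have x: "x \<in> X" and cc: "common_constraints nrmP C ?M lam mu eta q theta t"
      using feas unfolding P1 by auto
    have \<theta>: "0 \<le> theta" using cc by (simp add: common_constraints_def)
    have "\<exists>z v. dual_certificate (g k x) (Xi i) (?xh x i j) (t i j + \<delta>) z v \<and> dual_norm nrm z \<le> theta + \<delta>"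
      if jk: "j \<in> {1..?M i}" "k \<in> {1..K}" for i j k
    proof -
      obtain y where y: "y \<in> Xi i" "g k x y \<noteq> - \<infinity>" using g_pt[OF x jk(2)] by blast
      show ?thesis
      proof (rule dual_certificate_near_primal_bound[of "g k x", OF _ _ g_fin[OF x jk(2)] _ _ y n \<theta> \<delta>])
        show "concave_fun (g k x)" "usc_fun (g k x)" using assms(13) x jk(2) by auto
        show "convex (Xi i)" "closed (Xi i)" using assms(5) by auto
      qed (use feas jk in \<open>auto simp: P1\<close>)
    qed
    then have "\<forall>i j k. \<exists>z v. j \<in> {1..?M i} \<and> k \<in> {1..K} \<longrightarrow>
        dual_certificate (g k x) (Xi i) (?xh x i j) (t i j + \<delta>) z v \<and> dual_norm nrm z \<le> theta + \<delta>"
      by blast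
    then obtain z v where "\<forall>i j k. j \<in> {1..?M i} \<and> k \<in> {1..K} \<longrightarrow>
        dual_certificate (g k x) (Xi i) (?xh x i j) (t i j + \<delta>) (z i j k) (v i j k)
        \<and> dual_norm nrm (z i j k) \<le> theta + \<delta>"
      unfolding choice_iff by blast
    moreover have "slack_vec ?M mu (eta + \<delta>) q (\<lambda>i j. t i j + \<delta>) = slack_vec ?M mu eta q t"
      by (rule slack_vec_shift[OF num_points_pos])
    then have "common_constraints nrmP C ?M lam mu (eta + \<delta>) q (theta + \<delta>) (\<lambda>i j. t i j + \<delta>)"
      using cc \<delta> by (simp add: common_constraints_def)
    ultimately show ?thesis unfolding P1' using x by blast
  qed
  have "P1_value \<rho> \<epsilon> ?ph X f Xi nrm nrmP C ?M ?xh \<le> P1'_value \<rho> \<epsilon> ?ph X K g Xi nrm nrmP C ?M ?xh"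
    unfolding P1_value_def P1'_value_def using sound by (intro Inf_superset_mono) blast
  moreover have "P1'_value \<rho> \<epsilon> ?ph X K g Xi nrm nrmP C ?M ?xh \<le> P1_value \<rho> \<epsilon> ?ph X f Xi nrm nrmP C ?M ?xh"
    unfolding P1_value_def
  proof (rule Inf_greatest, safe)
    fix x lam mu eta q theta t
    assume feas: "P1_feasible X f Xi nrm nrmP C ?M ?xh x lam mu eta q theta t"
    show "P1'_value \<rho> \<epsilon> ?ph X K g Xi nrm nrmP C ?M ?xh \<le> ereal (objective \<rho> \<epsilon> ?M ?ph lam mu eta q theta t)"
    proof (rule ereal_le_epsilon2)
      fix e :: real assume e: "0 < e"
      \<comment> \<open>\<open>\<eta>\<close> and \<open>\<theta>\<close> enter the objective with the coefficients 1 and \<open>\<epsilon>\<close>.\<close>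
      define \<delta> where "\<delta> = e / (1 + \<epsilon>)"
      have \<delta>: "0 < \<delta>" "\<delta> * (1 + \<epsilon>) = e" using e \<open>\<epsilon> \<ge> 0\<close> by (auto simp: \<delta>_def)
      obtain z v where "P1'_feasible X K g Xi nrm nrmP C ?M ?xh x lam mu (eta + \<delta>) q z v
          (theta + \<delta>) (\<lambda>i j. t i j + \<delta>)"
        using complete[OF feas \<delta>(1)] by blast
      then have "P1'_value \<rho> \<epsilon> ?ph X K g Xi nrm nrmP C ?M ?xh
          \<le> ereal (objective \<rho> \<epsilon> ?M ?ph lam mu (eta + \<delta>) q (theta + \<delta>) (\<lambda>i j. t i j + \<delta>))"
        unfolding P1'_value_def by (intro Inf_lower) blast
      also have "\<dots> = ereal (objective \<rho> \<epsilon> ?M ?ph lam mu eta q theta t) + ereal e"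
        unfolding objective_def slack_vec_shift[OF num_points_pos]
        using \<delta>(2) by (simp add: algebra_simps)
      finally show "P1'_value \<rho> \<epsilon> ?ph X K g Xi nrm nrmP C ?M ?xh
          \<le> ereal (objective \<rho> \<epsilon> ?M ?ph lam mu eta q theta t) + ereal e" .
    qed
  qed
  moreover have "P1'_convex_at \<rho> \<epsilon> ?ph X K g Xi nrm nrmP C ?M ?xh x" for x
    unfolding P1'_convex_at_def
  proof (intro allI impI conjI)
    fix lam mu eta q z v theta t lam' mu' eta' q' z' v' theta' t' and a b :: real
    assume ab: "0 \<le> a" "0 \<le> b" "a + b = 1"
      and f1: "P1'_feasible X K g Xi nrm nrmP C ?M ?xh x lam mu eta q z v theta t"
      and f2: "P1'_feasible X K g Xi nrm nrmP C ?M ?xh x lam' mu' eta' q' z' v' theta' t'"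
    have \<theta>: "0 \<le> theta" "0 \<le> theta'" using f1 f2 by (auto simp: P1' common_constraints_def)
    show "P1'_feasible X K g Xi nrm nrmP C ?M ?xh x
        (a * lam + b * lam') (a *\<^sub>R mu + b *\<^sub>R mu') (a * eta + b * eta') (a *\<^sub>R q + b *\<^sub>R q')
        (\<lambda>i j k. a *\<^sub>R z i j k + b *\<^sub>R z' i j k) (\<lambda>i j k. a *\<^sub>R v i j k + b *\<^sub>R v' i j k)
        (a * theta + b * theta') (\<lambda>i j. a * t i j + b * t' i j)"
      using f1 f2 unfolding P1'
      by (auto intro!: common_constraints_convex_combination[OF nP ab]
          dual_certificate_convex_combination[OF _ _ ab] dual_norm_convex_combination[OF n \<theta> _ _ ab(1,2)])
    show "objective \<rho> \<epsilon> ?M ?ph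
        (a * lam + b * lam') (a *\<^sub>R mu + b *\<^sub>R mu') (a * eta + b * eta') (a *\<^sub>R q + b *\<^sub>R q')
        (a * theta + b * theta') (\<lambda>i j. a * t i j + b * t' i j)
      \<le> a * objective \<rho> \<epsilon> ?M ?ph lam mu eta q theta t + b * objective \<rho> \<epsilon> ?M ?ph lam' mu' eta' q' theta' t'"
      by (simp add: objective_linear_combination)
  qed
  ultimately show ?thesis by (blast intro: antisym)
qed

end
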